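(* Let $p$ be a prime, let $\gamma$ be a primitive element of $\mathbb{F}_{p^{2}}$, and for $i=0,1,\dots,p$ let $C_{i}=\gamma^{i}\langle\gamma^{p+1}\rangle$ be the cyclotomic classes of order $p+1$ in $\mathbb{F}_{p^{2}}$. Let $S_{i}=C_{i}\cup\{0\}$ for $i=0,1,\dots,p$. Fix $i',j'\in\{0,1,\dots,p\}$ with $i'\neq j'$. Let $m$ be a positive even integer and define $\Sigma_{l}=l+\{0,2,\dots,m-2\}\subset\mathbb{Z}_{m}$ for $l=0,1$. Then \[S_{i'j'}=(\Sigma_{0}\times S_{i'})\cup(\Sigma_{1}\times S_{j'})\] is a partial geometric difference set in the additive group $\mathbb{Z}_{m}\times\mathbb{F}_{p^{2}}$ with parameters $\left(mp^{2},\,mp;\,\left(\tfrac{m}{2}\right)^{2}p(p+3),\,\tfrac{3}{4}m^{2}p\right)$.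
   Context: Let $G$ be a finite additive Abelian group of order $v$. For $S\subseteq G$ and $z\in G$, let $\delta_{S}(z)=|\{(x,y)\in S\times S: z=x-y\}|$. Let $v>k>2$ be integers. A $k$-subset $S\subseteq G$ is a partial geometric difference set with parameters $(v,k;\alpha,\beta)$ if there are constants $\alpha,\beta$ such that for every $x\in G$, $\sum_{y\in S}\delta_{S}(x-y)=\alpha$ if $x\in S$ and $=\beta$ if $x\notin S$. *)

theory Defs
  imports "HOL-Computational_Algebra.Primes" "HOL-Algebra.Elementary_Groups" "HOL-Algebra.Multiplicative_Group"
begin

text \<open>Groups are in the multiplicative notation of HOL-Algebra: \<open>x \<otimes> inv y\<close> is the
  difference \<open>x - y\<close> of an additively written abelian group.\<close>

definition diff_count :: "('a, 'b) monoid_scheme \<Rightarrow> 'a set \<Rightarrow> 'a \<Rightarrow> nat"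
  where "diff_count G S z = card {(x, y) \<in> S \<times> S. z = x \<otimes>\<^bsub>G\<^esub> inv\<^bsub>G\<^esub> y}"

definition partial_geometric_difference_set ::
    "('a, 'b) monoid_scheme \<Rightarrow> nat \<Rightarrow> nat \<Rightarrow> nat \<Rightarrow> nat \<Rightarrow> 'a set \<Rightarrow> bool"
  where "partial_geometric_difference_set G v k \<alpha> \<beta> S \<longleftrightarrow>
    comm_group G \<and> finite (carrier G) \<and> order G = v \<and>
    v > k \<and> k > 2 \<and> S \<subseteq> carrier G \<and> card S = k \<and>
    (\<forall>x \<in> carrier G.
      (\<Sum>y\<in>S. diff_count G S (x \<otimes>\<^bsub>G\<^esub> inv\<^bsub>G\<^esub> y)) = (if x \<in> S then \<alpha> else \<beta>))"

definition primitive_element :: "('a, 'b) ring_scheme \<Rightarrow> 'a \<Rightarrow> bool"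
  where "primitive_element F \<gamma> \<longleftrightarrow>
    \<gamma> \<in> carrier (mult_of F) \<and> generate (mult_of F) {\<gamma>} = carrier (mult_of F)"

definition cyclotomic_class :: "('a, 'b) ring_scheme \<Rightarrow> nat \<Rightarrow> 'a \<Rightarrow> nat \<Rightarrow> 'a set"
  where "cyclotomic_class F e \<gamma> i =
    (\<gamma> [^]\<^bsub>mult_of F\<^esub> i) <#\<^bsub>mult_of F\<^esub> generate (mult_of F) {\<gamma> [^]\<^bsub>mult_of F\<^esub> e}"

text \<open>The translate \<open>l + {0, 2, \<dots>, m - 2}\<close> in \<open>\<int>\<^sub>m\<close>, whose elements are represented by
  the integers \<open>0, \<dots>, m - 1\<close>.\<close>

definition shifted_evens :: "nat \<Rightarrow> int \<Rightarrow> int set"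
  where "shifted_evens m l =
    l <#\<^bsub>integer_mod_group m\<^esub> {x. even x \<and> 0 \<le> x \<and> x \<le> int m - 2}"

end

theory Submission
  imports Defs "HOL-Algebra.Subrings" "HOL-Library.Indicator_Function"
begin

text \<open>
  Write \<open>1\<^sub>A\<close> for the indicator of \<open>A\<close> and \<open>\<star>\<close> for convolution, the product of the group ring. Then
  \<open>\<delta>\<^sub>S = 1\<^sub>S \<star> 1\<^bsub>-S\<^esub>\<close>, the sums in question are the values of \<open>\<delta>\<^sub>S \<star> 1\<^sub>S\<close>, and \<open>1\<^sub>A \<star> 1\<^sub>B = |A \<inter> B| 1\<^bsub>A+B\<^esub>\<close> for
  subgroups \<open>A\<close>, \<open>B\<close>.

  Let \<open>K\<close>, \<open>L\<close> be subgroups of equal order whose sum \<open>M = K + L\<close> has index two, let \<open>c \<notin> M\<close>, and let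
  \<open>S = K \<union> (c + L)\<close>. Since \<open>-c + M = c + M\<close>, expanding gives
  \<open>\<delta>\<^sub>S = |K| (1\<^sub>K + 1\<^sub>L) + 2 |K \<inter> L| 1\<^bsub>c+M\<^esub>\<close>, and hence
  \<open>\<delta>\<^sub>S \<star> 1\<^sub>S = |K|\<^sup>2 1\<^sub>S + 3 |K \<inter> L| |K| (1\<^sub>M + 1\<^bsub>c+M\<^esub>)\<close>, where the last bracket is constantly 1.

  This applies to \<open>K = E \<times> S\<^sub>i\<close>, \<open>L = E \<times> S\<^sub>j\<close> and \<open>c = (1, 0)\<close>, where \<open>E\<close> is the group of even residues. The
  \<open>S\<^sub>i\<close> are the \<open>p + 1\<close> lines through \<open>0\<close> of the plane \<open>F\<close> over its prime subfield, because the group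
  generated by \<open>\<gamma>\<^bsup>p+1\<^esup>\<close> and that of the nonzero elements of the subfield both consist of the roots of
  \<open>x\<^bsup>p-1\<^esup> = 1\<close>; so two of them are complementary subgroups of order \<open>p\<close>.
\<close>

subsection \<open>Convolution on a finite group\<close>

definition (in group) convolution ::
    "('a \<Rightarrow> 'c) \<Rightarrow> ('a \<Rightarrow> 'c) \<Rightarrow> 'a \<Rightarrow> 'c::comm_semiring_1"  (infixl "\<star>" 70)
  where "(f \<star> g) x = (\<Sum>y\<in>carrier G. f (x \<otimes> inv y) * g y)"

context group
begin

lemma convolution_add_left: "((\<lambda>y. f y + g y) \<star> h) x = (f \<star> h) x + (g \<star> h) x"
  by (simp add: convolution_def distrib_right sum.distrib)

lemma convolution_add_right: "(f \<star> (\<lambda>y. g y + h y)) x = (f \<star> g) x + (f \<star> h) x"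
  by (simp add: convolution_def distrib_left sum.distrib)

lemma convolution_scale_left: "((\<lambda>y. a * f y) \<star> g) x = a * (f \<star> g) x"
  by (simp add: convolution_def sum_distrib_left mult.assoc)

lemma convolution_cong_left:
  assumes "\<And>y. y \<in> carrier G \<Longrightarrow> f y = g y" and "x \<in> carrier G"
  shows "(f \<star> h) x = (g \<star> h) x"
  using assms by (simp add: convolution_def)

lemma convolution_indicator_right:
  assumes "finite (carrier G)" "S \<subseteq> carrier G"
  shows "(f \<star> indicator S) x = (\<Sum>y\<in>S. f (x \<otimes> inv y))"
  using assms by (simp add: convolution_def Int_absorb1)

lemma convolution_indicator_indicator:
  assumes "finite (carrier G)" "B \<subseteq> carrier G"
  shows "(indicator A \<star> indicator B) x = of_nat (card {y \<in> B. x \<otimes> inv y \<in> A})"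
proof -
  have "finite B"
    using assms finite_subset by blast
  then show ?thesis
    using assms by (simp add: convolution_indicator_right indicator_def Collect_conj_eq)
qed

lemma diff_count_eq_convolution:
  assumes "finite (carrier G)" "S \<subseteq> carrier G" "x \<in> carrier G"
  shows "diff_count G S x = (indicator S \<star> indicator (m_inv G ` S)) x"
proof -
  have "bij_betw (\<lambda>(a, b). inv b)
      {(a, b) \<in> S \<times> S. x = a \<otimes> inv b} {y \<in> m_inv G ` S. x \<otimes> inv y \<in> S}"
    by (rule bij_betw_byWitness[where f' = "\<lambda>y. (x \<otimes> inv y, inv y)"])
      (use assms in \<open>auto simp: m_assoc subset_iff\<close>)
  moreover have "m_inv G ` S \<subseteq> carrier G"
    using assms by auto
  ultimately show ?thesis
    using assms by (simp add: diff_count_def convolution_indicator_indicator bij_betw_same_card)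
qed

lemma Collect_mult_inv_mem_eq_r_coset:
  assumes "subgroup A G" "subgroup B G" "a \<in> A" "b \<in> B"
  shows "{y \<in> B. a \<otimes> b \<otimes> inv y \<in> A} = (A \<inter> B) #> b"
proof -
  interpret A: subgroup A G by fact
  interpret B: subgroup B G by fact
  interpret AB: subgroup "A \<inter> B" G
    using assms by (intro subgroups_Inter_pair)
  show ?thesis
  proof (intro equalityI subsetI)
    fix y assume "y \<in> {y \<in> B. a \<otimes> b \<otimes> inv y \<in> A}"
    then have y: "y \<in> B" "a \<otimes> b \<otimes> inv y \<in> A" by auto
    have "y \<otimes> inv b = inv (a \<otimes> b \<otimes> inv y) \<otimes> a"
      using assms y(1) by (simp add: inv_mult_group m_assoc)
    also have "\<dots> \<in> A"
      using assms(3) y(2) by blast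
    finally show "y \<in> (A \<inter> B) #> b"
      using assms y(1) by (simp add: AB.rcos_module[OF is_group])
  next
    fix y assume "y \<in> (A \<inter> B) #> b"
    then obtain h where h: "h \<in> A" "h \<in> B" "y = h \<otimes> b"
      by (auto simp: r_coset_def)
    then have "y \<in> B" "y \<otimes> inv b = h"
      using assms(4) by (simp_all add: m_assoc)
    then have "a \<otimes> b \<otimes> inv y = a \<otimes> inv h"
      using assms by (auto simp: inv_mult_group m_assoc)
    then show "y \<in> {y \<in> B. a \<otimes> b \<otimes> inv y \<in> A}"
      using assms(3) h(1) \<open>y \<in> B\<close> by simp
  qed
qed

lemma convolution_subgroups:
  assumes "finite (carrier G)" "subgroup A G" "subgroup B G" "x \<in> carrier G"
  shows "(indicator A \<star> indicator B) x = of_nat (card (A \<inter> B)) * indicator (A <#> B) x"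
proof (cases "x \<in> A <#> B")
  case True
  then obtain a b where ab: "a \<in> A" "b \<in> B" "x = a \<otimes> b"
    by (auto simp: set_mult_def)
  have subset: "A \<inter> B \<subseteq> carrier G" "B \<subseteq> carrier G"
    using assms(2,3) subgroup.subset by auto
  have "{y \<in> B. x \<otimes> inv y \<in> A} = (A \<inter> B) #> b"
    unfolding ab(3) using assms(2,3) ab(1,2) by (rule Collect_mult_inv_mem_eq_r_coset)
  then have "card {y \<in> B. x \<otimes> inv y \<in> A} = card (A \<inter> B)"
    using card_rcosets_equal[OF rcosetsI[OF subset(1)] subset(1), of b] ab(2) subset(2) by auto
  then show ?thesis
    using True assms(1) subset(2) by (simp add: convolution_indicator_indicator)
next
  case False
  interpret B: subgroup B G by fact
  have "x \<in> A <#> B" if "y \<in> B" "x \<otimes> inv y \<in> A" for y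
  proof -
    have "x = x \<otimes> inv y \<otimes> y"
      using that assms by (simp add: m_assoc)
    then show ?thesis
      using that unfolding set_mult_def by blast
  qed
  then have empty: "{y \<in> B. x \<otimes> inv y \<in> A} = {}"
    using False by blast
  show ?thesis
    using False assms(1) by (simp add: convolution_indicator_indicator B.subset empty)
qed

lemma mem_l_coset_iff:
  assumes "A \<subseteq> carrier G" "a \<in> carrier G" "x \<in> carrier G"
  shows "x \<in> a <# A \<longleftrightarrow> inv a \<otimes> x \<in> A"
proof
  assume "inv a \<otimes> x \<in> A"
  moreover have "x = a \<otimes> (inv a \<otimes> x)"
    using assms by (simp add: m_assoc[symmetric])
  ultimately show "x \<in> a <# A"
    unfolding l_coset_def by blast
qed (use assms in \<open>auto simp: l_coset_def m_assoc[symmetric] subset_iff\<close>)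

lemma indicator_l_coset:
  assumes "A \<subseteq> carrier G" "a \<in> carrier G" "x \<in> carrier G"
  shows "indicator (a <# A) x = indicator A (inv a \<otimes> x)"
  using assms by (simp add: indicator_def mem_l_coset_iff)

lemma convolution_l_coset_left:
  assumes "A \<subseteq> carrier G" "a \<in> carrier G" "x \<in> carrier G"
  shows "(indicator (a <# A) \<star> f) x = (indicator A \<star> f) (inv a \<otimes> x)"
  using assms by (simp add: convolution_def indicator_l_coset m_assoc)

lemma card_l_coset:
  assumes "A \<subseteq> carrier G" "a \<in> carrier G"
  shows "card (a <# A) = card A"
proof -
  have "a <# A = (\<otimes>) a ` A"
    by (auto simp: l_coset_def)
  then show ?thesis
    using assms by (simp add: card_image inj_on_subset[OF inj_on_cmult])
qed

lemma subset_set_mult_subgroup: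
  assumes "A \<subseteq> carrier G" "subgroup B G"
  shows "A \<subseteq> A <#> B"
proof -
  have "A = A <#> {\<one>}"
    using assms(1) by (simp add: coset_mult_one flip: r_coset_eq_set_mult)
  also have "\<dots> \<subseteq> A <#> B"
    using subgroup.one_closed[OF assms(2)] by (intro mono_set_mult) auto
  finally show ?thesis .
qed

lemma subgroup_Int_l_coset_eq_empty:
  assumes "subgroup H G" "A \<subseteq> H" "a \<in> carrier G" "a \<notin> H"
  shows "H \<inter> (a <# A) = {}"
proof -
  interpret H: subgroup H G by fact
  have "a \<otimes> h \<notin> H" if "h \<in> A" for h
  proof
    assume "a \<otimes> h \<in> H"
    then have "a \<otimes> h \<otimes> inv h \<in> H"
      using that assms(2) by (intro H.m_closed[OF _ H.m_inv_closed]) auto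
    then show False
      using that assms by (simp add: m_assoc subset_iff)
  qed
  then show ?thesis
    by (auto simp: l_coset_def)
qed

lemma order_eq_two_card_subgroup:
  assumes "finite (carrier G)" "subgroup H G"
    and "a \<in> carrier G" "a \<notin> H" "carrier G = H \<union> (a <# H)"
  shows "order G = 2 * card H"
proof -
  have subset: "H \<subseteq> carrier G" "a <# H \<subseteq> carrier G"
    using assms(5) by auto
  have "order G = card H + card (a <# H)"
    unfolding order_def assms(5)
    using subset assms(1) subgroup_Int_l_coset_eq_empty[OF assms(2) _ assms(3,4)]
    by (intro card_Un_disjoint) (auto intro: finite_subset)
  also have "card (a <# H) = card H"
    using subset(1) assms(3) by (rule card_l_coset)
  finally show ?thesis by simp
qed

lemma set_mult_eq_carrier:
  assumes "finite (carrier G)" "subgroup A G" "subgroup B G"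
    and "A \<inter> B = {\<one>}" "card A * card B = order G"
  shows "A <#> B = carrier G"
proof (rule card_subset_eq)
  interpret group_disjoint_sum G A B
    using assms by (simp add: group_disjoint_sum_def)
  have "\<forall>a\<in>A. \<forall>b\<in>B. \<forall>a'\<in>A. \<forall>b'\<in>B. a \<otimes> b = a' \<otimes> b' \<longrightarrow> a = a' \<and> b = b'"
    by (rule iffD1[OF cancel]) (simp add: assms(4))
  then have "inj_on (\<lambda>(a, b). a \<otimes> b) (A \<times> B)"
    unfolding inj_on_def by simp
  moreover have "A <#> B = (\<lambda>(a, b). a \<otimes> b) ` (A \<times> B)"
    by (auto simp: set_mult_def)
  ultimately show "card (A <#> B) = card (carrier G)"
    using assms(5) by (simp add: card_image card_cartesian_product order_def)
  show "A <#> B \<subseteq> carrier G"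
    by (rule set_mult_closed[OF AG.subset BG.subset])
qed fact

end

context comm_group
begin

lemma convolution_l_coset_right:
  assumes "B \<subseteq> carrier G" "b \<in> carrier G" "x \<in> carrier G"
  shows "(f \<star> indicator (b <# B)) x = (f \<star> indicator B) (inv b \<otimes> x)"
proof -
  have "(f \<star> indicator (b <# B)) x =
      (\<Sum>y\<in>carrier G. f (x \<otimes> inv (b \<otimes> y)) * indicator (b <# B) (b \<otimes> y))"
    unfolding convolution_def
    by (rule sum.reindex_bij_witness[where i = "\<lambda>y. b \<otimes> y" and j = "\<lambda>y. inv b \<otimes> y"])
      (use assms in \<open>auto simp: m_assoc[symmetric]\<close>)
  also have "\<dots> = (f \<star> indicator B) (inv b \<otimes> x)"
    unfolding convolution_def
  proof (rule sum.cong)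
    fix y assume "y \<in> carrier G"
    moreover from this have "inv b \<otimes> (b \<otimes> y) = y"
      using assms by (simp add: m_assoc[symmetric])
    ultimately show "f (x \<otimes> inv (b \<otimes> y)) * indicator (b <# B) (b \<otimes> y) =
        f (inv b \<otimes> x \<otimes> inv y) * indicator B y"
      using assms by (simp add: indicator_l_coset inv_mult m_ac)
  qed simp
  finally show ?thesis .
qed

lemma image_m_inv_l_coset:
  assumes "subgroup H G" "a \<in> carrier G"
  shows "m_inv G ` (a <# H) = inv a <# H"
proof -
  interpret H: subgroup H G by fact
  have "\<exists>h'\<in>H. inv a \<otimes> h = inv (a \<otimes> h')" if "h \<in> H" for h
    using that assms by (intro bexI[of _ "inv h"]) (auto simp: inv_mult)
  then show ?thesis
    using assms by (auto simp: l_coset_def inv_mult image_iff)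
qed

end

lemma (in group) image_m_inv_subgroup:
  assumes "subgroup H G"
  shows "m_inv G ` H = H"
proof -
  interpret H: subgroup H G by fact
  have "h \<in> m_inv G ` H" if "h \<in> H" for h
    using that by (intro image_eqI[of _ _ "inv h"]) auto
  then show ?thesis
    by auto
qed

subsection \<open>Two subgroups of equal order with a product of index two\<close>

locale index_two_subgroup_product = comm_group G for G (structure) +
  fixes K L :: "'a set" and c :: 'a
  assumes finite_carrier: "finite (carrier G)"
    and subgroup_K: "subgroup K G" and subgroup_L: "subgroup L G"
    and card_L: "card L = card K"
    and c_closed [simp]: "c \<in> carrier G" and c_notin: "c \<notin> K <#> L"
    and carrier_eq: "carrier G = (K <#> L) \<union> (c <# (K <#> L))"
begin

sublocale K: subgroup K G by (fact subgroup_K)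
sublocale L: subgroup L G by (fact subgroup_L)

abbreviation M :: "'a set"
  where "M \<equiv> K <#> L"

abbreviation S :: "'a set"
  where "S \<equiv> K \<union> (c <# L)"

sublocale M: subgroup M G
  by (rule mult_subgroups[OF subgroup_K subgroup_L])

lemma L_mult_K: "L <#> K = M"
  by (rule commut_normal[OF subgroup_L subgroup_imp_normal[OF subgroup_K]])

lemma K_subset_M: "K \<subseteq> M"
  by (rule subset_set_mult_subgroup[OF K.subset subgroup_L])

lemma L_subset_M: "L \<subseteq> M"
  using subset_set_mult_subgroup[OF L.subset subgroup_K] by (simp only: L_mult_K)

lemma M_mult_subgroup:
  assumes "subgroup A G" "A \<subseteq> M"
  shows "M <#> A = M"
  using assms by (intro set_mult_subgroup_idem subgroup_incl M.subgroup_axioms)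

lemma inv_c_mult_mem_M_iff:
  assumes "x \<in> carrier G"
  shows "inv c \<otimes> x \<in> M \<longleftrightarrow> x \<notin> M"
proof
  assume "inv c \<otimes> x \<in> M"
  show "x \<notin> M"
  proof
    assume "x \<in> M"
    then have "x \<otimes> inv (inv c \<otimes> x) \<in> M"
      using \<open>inv c \<otimes> x \<in> M\<close> by (rule M.m_closed[OF _ M.m_inv_closed])
    moreover have "x \<otimes> inv (inv c \<otimes> x) = c"
      using assms by (simp add: inv_mult m_lcomm)
    ultimately show False
      using c_notin by simp
  qed
next
  assume "x \<notin> M"
  then show "inv c \<otimes> x \<in> M"
    using assms carrier_eq mem_l_coset_iff[OF M.subset c_closed] by blast
qed

lemma c_mult_mem_M_iff:
  assumes "x \<in> carrier G"
  shows "c \<otimes> x \<in> M \<longleftrightarrow> x \<notin> M"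
  using inv_c_mult_mem_M_iff[of "c \<otimes> x"] assms by (auto simp: m_assoc[symmetric])

lemma K_Int_l_coset_L_eq_empty:
  assumes "d \<in> carrier G" "d \<notin> M"
  shows "K \<inter> (d <# L) = {}"
  using subgroup_Int_l_coset_eq_empty[OF M.subgroup_axioms L_subset_M assms] K_subset_M by blast

lemma S_subset: "S \<subseteq> carrier G"
  using K.subset l_coset_subset_G[OF L.subset c_closed] by simp

lemma indicator_S: "indicator S = (\<lambda>x. indicator K x + indicator (c <# L) x :: nat)"
  using K_Int_l_coset_L_eq_empty[OF c_closed c_notin] by (intro ext indicator_disj_union)

lemma indicator_inv_S:
  "indicator (m_inv G ` S) = (\<lambda>x. indicator K x + indicator (inv c <# L) x :: nat)"
proof -
  have "inv c \<notin> M"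
    using M.m_inv_closed[of "inv c"] c_notin by auto
  then have "K \<inter> (inv c <# L) = {}"
    by (simp add: K_Int_l_coset_L_eq_empty)
  then show ?thesis
    by (simp add: image_Un image_m_inv_subgroup subgroup_K subgroup_L image_m_inv_l_coset
        indicator_disj_union fun_eq_iff)
qed

lemma card_S: "card S = 2 * card K"
proof -
  have "finite K" "finite (c <# L)"
    using S_subset finite_carrier finite_subset by auto
  then show ?thesis
    using K_Int_l_coset_L_eq_empty[OF c_closed c_notin]
    by (simp add: card_Un_disjoint card_l_coset L.subset card_L)
qed

lemma diff_count_S:
  assumes "x \<in> carrier G"
  shows "diff_count G S x =
    card K * (indicator K x + indicator L x) + 2 * card (K \<inter> L) * indicator (c <# M) x"
proof -
  have indicator_c_mult: "indicator M (c \<otimes> x) = (indicator M (inv c \<otimes> x) :: nat)"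
    using assms by (simp add: indicator_def c_mult_mem_M_iff inv_c_mult_mem_M_iff)
  have cancel: "c \<otimes> (inv c \<otimes> x) = x" "inv c \<otimes> (c \<otimes> x) = x"
    using assms by (simp_all add: m_assoc[symmetric])
  have "diff_count G S x = (indicator S \<star> indicator (m_inv G ` S)) x"
    by (rule diff_count_eq_convolution[OF finite_carrier S_subset assms])
  also have "\<dots> = ((\<lambda>x. indicator K x + indicator (c <# L) x) \<star>
      (\<lambda>x. indicator K x + indicator (inv c <# L) x)) x"
    by (simp only: indicator_S indicator_inv_S)
  also have "\<dots> = (indicator K \<star> indicator K) x + (indicator K \<star> indicator L) (c \<otimes> x) +
      (indicator L \<star> indicator K) (inv c \<otimes> x) + (indicator L \<star> indicator L) x"
    using assms
    by (simp add: convolution_add_left convolution_add_right convolution_l_coset_left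
        convolution_l_coset_right L.subset cancel)
  also have "\<dots> = card K * (indicator K x + indicator L x) +
      2 * card (K \<inter> L) * indicator (c <# M) x"
    using assms
    by (simp add: convolution_subgroups finite_carrier subgroup_K subgroup_L subgroup_mult_id
        L_mult_K card_L Int_commute[of L K] indicator_l_coset M.subset indicator_c_mult distrib_left)
  finally show ?thesis .
qed

lemma sum_diff_count_S:
  assumes "x \<in> carrier G"
  shows "(\<Sum>y\<in>S. diff_count G S (x \<otimes> inv y)) =
    (card K)\<^sup>2 * indicator S x + 3 * card (K \<inter> L) * card K"
proof -
  have Int_eqs: "M \<inter> K = K" "M \<inter> L = L" "L \<inter> K = K \<inter> L"
    using K_subset_M L_subset_M by auto
  have partition: "indicator M x + indicator M (inv c \<otimes> x) = (1 :: nat)"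
    using assms by (simp add: indicator_def inv_c_mult_mem_M_iff)
  have indicator_inv_c_twice: "indicator M (inv c \<otimes> (inv c \<otimes> x)) = (indicator M x :: nat)"
    using assms by (simp add: indicator_def inv_c_mult_mem_M_iff)
  have "(\<Sum>y\<in>S. diff_count G S (x \<otimes> inv y)) = (diff_count G S \<star> indicator S) x"
    by (simp only: convolution_indicator_right[OF finite_carrier S_subset])
  also have "\<dots> = ((\<lambda>x. card K * (indicator K x + indicator L x) +
      2 * card (K \<inter> L) * indicator (c <# M) x) \<star> indicator S) x"
    using diff_count_S assms by (rule convolution_cong_left)
  also have "\<dots> =
      card K * ((indicator K \<star> indicator K) x + (indicator L \<star> indicator K) x +
        (indicator K \<star> indicator L) (inv c \<otimes> x) + (indicator L \<star> indicator L) (inv c \<otimes> x)) +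
      2 * card (K \<inter> L) * ((indicator M \<star> indicator K) (inv c \<otimes> x) +
        (indicator M \<star> indicator L) (inv c \<otimes> (inv c \<otimes> x)))"
    using assms
    by (simp add: indicator_S convolution_add_left convolution_add_right convolution_scale_left
        convolution_l_coset_left convolution_l_coset_right L.subset M.subset algebra_simps)
  also have "\<dots> = (card K)\<^sup>2 * indicator S x +
      3 * card (K \<inter> L) * card K * (indicator M x + indicator M (inv c \<otimes> x))"
    using assms
    by (simp add: convolution_subgroups finite_carrier subgroup_K subgroup_L M.subgroup_axioms
        subgroup_mult_id L_mult_K M_mult_subgroup K_subset_M L_subset_M card_L Int_eqs indicator_inv_c_twice
        indicator_S indicator_l_coset L.subset power2_eq_square algebra_simps)
  finally show ?thesis
    by (simp only: partition mult_1_right)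
qed

lemma partial_geometric_difference_set_S:
  assumes "card K > 1" "2 * card K < order G"
  shows "partial_geometric_difference_set G (order G) (2 * card K)
    ((card K)\<^sup>2 + 3 * card (K \<inter> L) * card K) (3 * card (K \<inter> L) * card K) S"
  using assms comm_group_axioms finite_carrier S_subset
  by (simp add: partial_geometric_difference_set_def card_S sum_diff_count_S)

end

subsection \<open>Direct products\<close>

lemma set_mult_DirProd: "(A \<times> B) <#>\<^bsub>G \<times>\<times> H\<^esub> (C \<times> D) = (A <#>\<^bsub>G\<^esub> C) \<times> (B <#>\<^bsub>H\<^esub> D)"
  by (force simp: set_mult_def)

lemma l_coset_DirProd: "(a, b) <#\<^bsub>G \<times>\<times> H\<^esub> (C \<times> D) = (a <#\<^bsub>G\<^esub> C) \<times> (b <#\<^bsub>H\<^esub> D)"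
  by (force simp: l_coset_def)

lemma comm_group_DirProd:
  assumes "comm_group G" "comm_group H"
  shows "comm_group (G \<times>\<times> H)"
proof (rule group.group_comm_groupI)
  show "group (G \<times>\<times> H)"
    using assms by (simp add: DirProd_group comm_group.axioms)
qed (use assms in \<open>auto simp: comm_group_def comm_monoid.m_comm\<close>)

lemma index_two_subgroup_product_DirProd:
  assumes "comm_group Z" "finite (carrier Z)" "subgroup E Z"
    and "e \<in> carrier Z" "e \<notin> E" "carrier Z = E \<union> (e <#\<^bsub>Z\<^esub> E)"
    and "comm_group V" "finite (carrier V)" "subgroup A V" "subgroup B V"
    and "card A = card B" "A <#>\<^bsub>V\<^esub> B = carrier V"
  shows "index_two_subgroup_product (Z \<times>\<times> V) (E \<times> A) (E \<times> B) (e, \<one>\<^bsub>V\<^esub>)"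
proof -
  interpret Z: comm_group Z by fact
  interpret V: comm_group V by fact
  have product: "(E \<times> A) <#>\<^bsub>Z \<times>\<times> V\<^esub> (E \<times> B) = E \<times> carrier V"
    using assms by (simp add: set_mult_DirProd Z.subgroup_mult_id)
  show ?thesis
  proof (intro index_two_subgroup_product.intro index_two_subgroup_product_axioms.intro)
    show "comm_group (Z \<times>\<times> V)"
      by (rule comm_group_DirProd) fact+
    show "subgroup (E \<times> A) (Z \<times>\<times> V)" "subgroup (E \<times> B) (Z \<times>\<times> V)"
      using assms by (auto intro!: DirProd_subgroups Z.is_group V.is_group)
    show "carrier (Z \<times>\<times> V) =
        (E \<times> A <#>\<^bsub>Z \<times>\<times> V\<^esub> E \<times> B) \<union> ((e, \<one>\<^bsub>V\<^esub>) <#\<^bsub>Z \<times>\<times> V\<^esub> (E \<times> A <#>\<^bsub>Z \<times>\<times> V\<^esub> E \<times> B))"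
      using assms(6) by (simp add: product l_coset_DirProd V.lcos_mult_one Sigma_Un_distrib1)
  qed (use assms product in \<open>auto simp: card_cartesian_product\<close>)
qed

lemma partial_geometric_difference_set_DirProd:
  assumes "comm_group Z" "finite (carrier Z)" "subgroup E Z"
    and "e \<in> carrier Z" "e \<notin> E" "carrier Z = E \<union> (e <#\<^bsub>Z\<^esub> E)"
    and "comm_group V" "subgroup A V" "subgroup B V" "A \<inter> B = {\<one>\<^bsub>V\<^esub>}"
    and "card A = n" "card B = n" "order V = n\<^sup>2" "n > 1"
  shows "partial_geometric_difference_set (Z \<times>\<times> V) (order Z * n\<^sup>2) (order Z * n)
    ((card E)\<^sup>2 * (n * (n + 3))) (3 * (card E)\<^sup>2 * n) ((E \<times> A) \<union> ((e <#\<^bsub>Z\<^esub> E) \<times> B))"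
proof -
  interpret Z: comm_group Z by fact
  interpret V: comm_group V by fact
  interpret E: subgroup E Z by fact
  have finite_V: "finite (carrier V)"
    using assms(13,14) V.order_gt_0_iff_finite by simp
  have "A <#>\<^bsub>V\<^esub> B = carrier V"
    using assms finite_V by (intro V.set_mult_eq_carrier) (auto simp: power2_eq_square)
  then interpret index_two_subgroup_product "Z \<times>\<times> V" "E \<times> A" "E \<times> B" "(e, \<one>\<^bsub>V\<^esub>)"
    using assms finite_V by (intro index_two_subgroup_product_DirProd) auto
  have order_Z: "order Z = 2 * card E"
    using assms by (intro Z.order_eq_two_card_subgroup)
  have card_E: "card E > 0"
    using assms(2) by (rule E.finite_imp_card_positive)
  have translate: "(e, \<one>\<^bsub>V\<^esub>) <#\<^bsub>Z \<times>\<times> V\<^esub> (E \<times> B) = (e <#\<^bsub>Z\<^esub> E) \<times> B"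
    using assms by (simp add: l_coset_DirProd V.lcos_mult_one subgroup.subset)
  have "order (Z \<times>\<times> V) = order Z * n\<^sup>2"
    using assms by (simp add: order_def card_cartesian_product)
  moreover have "card (E \<times> A) = card E * n" "card ((E \<times> A) \<inter> (E \<times> B)) = card E"
    using assms by (simp_all add: Times_Int_Times card_cartesian_product)
  moreover have "1 < card E * n"
    using card_E assms(14) less_le_trans[of 1 n "card E * n"] by simp
  moreover have "n < n\<^sup>2"
    using assms(14) by (simp add: power2_eq_square)
  ultimately show ?thesis
    using partial_geometric_difference_set_S card_E assms(14)
    by (simp add: order_Z translate power2_eq_square algebra_simps)
qed

subsection \<open>Lines over a subfield in a quadratic extension\<close>

lemma (in domain) nat_pow_nonzero:
  "x \<in> carrier R \<Longrightarrow> x \<noteq> \<zero> \<Longrightarrow> x [^] (n :: nat) \<noteq> \<zero>"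
  by (induction n) (auto simp: integral_iff)

lemma (in semiring) add_pow_one_nat_pow: "([k] \<cdot> \<one>) [^] (n :: nat) = [(k ^ n)] \<cdot> \<one>" for k :: nat
  by (induction n) (simp_all add: add_pow_rdistr add.nat_pow_pow mult.commute)

lemma (in domain) add_ord_one_eq_prime:
  assumes "prime p" "order R = p ^ n"
  shows "add.ord \<one> = p"
proof -
  have "([p] \<cdot> \<one>) [^] n = \<zero>"
    using add.pow_order_eq_1[of \<one>] assms(2) by (simp add: add_pow_one_nat_pow order_def)
  then have "[p] \<cdot> \<one> = \<zero>"
    using nat_pow_nonzero[of "[p] \<cdot> \<one>" n] by auto
  then have "add.ord \<one> dvd p"
    by (simp add: add.pow_eq_id[symmetric])
  moreover have "add.ord \<one> \<noteq> 1"
    using add.ord_eq_1[of \<one>] by auto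
  ultimately show ?thesis
    using assms(1) unfolding prime_nat_iff by blast
qed

lemma (in ring) subring_generate_one: "subring (generate (add_monoid R) {\<one>}) R"
proof -
  interpret P: subgroup "generate (add_monoid R) {\<one>}" "add_monoid R"
    by (rule add.generate_is_subgroup) simp
  have "x \<otimes> y \<in> generate (add_monoid R) {\<one>}"
    if "x \<in> generate (add_monoid R) {\<one>}" "y \<in> generate (add_monoid R) {\<one>}" for x y
    using that(1)
  proof (induction rule: generate.induct)
    case one
    show ?case
      using that(2) P.one_closed P.mem_carrier by simp
  next
    case (incl h)
    then show ?case
      using that(2) P.mem_carrier by simp
  next
    case (inv h)
    then have "inv\<^bsub>add_monoid R\<^esub> h \<otimes> y = \<ominus> y"
      using P.mem_carrier[OF that(2)] by (simp add: l_minus flip: a_inv_def)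
    then show ?case
      using P.m_inv_closed[OF that(2)] by (simp add: a_inv_def)
  next
    case (eng h1 h2)
    have "(h1 \<oplus> h2) \<otimes> y = h1 \<otimes> y \<oplus> h2 \<otimes> y"
      using P.mem_carrier[OF eng.hyps(1)] P.mem_carrier[OF eng.hyps(2)] P.mem_carrier[OF that(2)]
      by (simp add: l_distr)
    then show ?case
      using P.m_closed[OF eng.IH] by simp
  qed
  then show ?thesis
    using P.subset P.m_closed P.m_inv_closed generate.incl[of \<one> "{\<one>}" "add_monoid R"]
    by (intro subringI) (auto simp: a_inv_def)
qed

lemma (in field) finite_subring_imp_subfield:
  assumes "subring K R" "finite K"
  shows "subfield K R"
proof (rule subfieldI'[OF assms(1)])
  fix k assume k: "k \<in> K - {\<zero>}"
  have "inj_on ((\<otimes>) k) K"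
    using k subringE(1)[OF assms(1)] by (auto simp: inj_on_def m_lcancel subset_iff)
  moreover have "(\<otimes>) k ` K \<subseteq> K"
    using k subringE(6)[OF assms(1)] by auto
  ultimately have "(\<otimes>) k ` K = K"
    using assms(2) by (intro endo_inj_surj)
  then obtain x where "x \<in> K" "k \<otimes> x = \<one>"
    using subringE(3)[OF assms(1)] by (metis imageE)
  then show "inv k \<in> K"
    using k subringE(1)[OF assms(1)] comm_inv_char[of k x] by auto
qed

lemma (in field) ex_subfield_card_prime:
  assumes "prime p" "order R = p ^ n"
  shows "\<exists>K. subfield K R \<and> card K = p"
proof (intro exI conjI)
  show card: "card (generate (add_monoid R) {\<one>}) = p"
    using add.generate_pow_card[of \<one>] add_ord_one_eq_prime[OF assms] by simp
  show "subfield (generate (add_monoid R) {\<one>}) R"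
  proof (rule finite_subring_imp_subfield[OF subring_generate_one])
    show "finite (generate (add_monoid R) {\<one>})"
      using card prime_gt_0_nat[OF assms(1)] card_ge_0_finite by metis
  qed
qed

lemma (in field) subgroup_mult_of_eq_roots_of_unity:
  assumes "finite (carrier R)" "subgroup H (mult_of R)"
  shows "H = {x \<in> carrier R. x [^] card H = \<one>}"
proof (rule card_seteq)
  interpret mult: group "mult_of R"
    by (rule field_mult_group)
  interpret H: subgroup H "mult_of R" by fact
  show "finite {x \<in> carrier R. x [^] card H = \<one>}"
    using assms(1) by simp
  have "H \<subseteq> carrier R"
    using H.subset by auto
  then have "finite H"
    using assms(1) finite_subset by blast
  then have "card H \<noteq> 0"
    using H.one_closed by auto
  then show "card {x \<in> carrier R. x [^] card H = \<one>} \<le> card H"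
    by (rule num_roots_le_deg[OF assms(1)])
  interpret HG: group "mult_of R\<lparr>carrier := H\<rparr>"
    by (rule H.subgroup_is_group) (rule mult.is_group)
  have "x [^] card H = \<one>" if "x \<in> H" for x
    using HG.pow_order_eq_1[of x] that
    by (simp add: order_def nat_pow_def nat_pow_mult_of[symmetric])
  then show "H \<subseteq> {x \<in> carrier R. x [^] card H = \<one>}"
    using \<open>H \<subseteq> carrier R\<close> by auto
qed

locale finite_quadratic_extension = field R for R (structure) +
  fixes K :: "'a set" and \<gamma> :: 'a
  assumes finite_carrier: "finite (carrier R)"
    and subfield_K: "subfield K R" and order_eq: "order R = (card K)\<^sup>2"
    and primitive: "primitive_element R \<gamma>"
begin

sublocale mult: group "mult_of R"
  by (rule field_mult_group)

definition line :: "nat \<Rightarrow> 'a set"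
  where "line i = cyclotomic_class R (card K + 1) \<gamma> i \<union> {\<zero>}"

lemma gamma_closed: "\<gamma> \<in> carrier (mult_of R)"
  using primitive by (simp add: primitive_element_def)

lemma gamma_pow_closed: "\<gamma> [^] (i :: nat) \<in> carrier R" "\<gamma> [^] (i :: nat) \<noteq> \<zero>"
  using mult.nat_pow_closed[OF gamma_closed, of i] by (simp_all add: nat_pow_mult_of)

lemma card_K_gt_1: "card K > 1"
proof -
  have "finite K"
    using subfieldE(3)[OF subfield_K] finite_carrier finite_subset by blast
  moreover have "{\<zero>, \<one>} \<subseteq> K"
    using subringE(2,3)[OF subfieldE(1)[OF subfield_K]] by simp
  ultimately have "card {\<zero>, \<one>} \<le> card K"
    by (rule card_mono)
  then show ?thesis
    by simp
qed

lemma ord_gamma: "mult.ord \<gamma> = (card K + 1) * (card K - 1)"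
proof -
  have "mult.ord \<gamma> = order (mult_of R)"
    using mult.generate_pow_card[OF gamma_closed] primitive
    by (simp add: primitive_element_def order_def)
  also have "\<dots> = (card K)\<^sup>2 - 1"
    using order_mult_of[OF finite_carrier] order_eq by simp
  also have "\<dots> = (card K + 1) * (card K - 1)"
    by (simp add: power2_eq_square algebra_simps)
  finally show ?thesis .
qed

lemma nonzero_subfield_eq_roots_of_unity: "K - {\<zero>} = {x \<in> carrier R. x [^] (card K - 1) = \<one>}"
  using subgroup_mult_of_eq_roots_of_unity[OF finite_carrier subgroup_mult_of[OF subfield_K]]
    subringE(2)[OF subfieldE(1)[OF subfield_K]] by (simp add: card_Diff_singleton)

lemma generate_gamma_pow: "generate (mult_of R) {\<gamma> [^]\<^bsub>mult_of R\<^esub> (card K + 1)} = K - {\<zero>}"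
proof -
  let ?\<delta> = "\<gamma> [^]\<^bsub>mult_of R\<^esub> (card K + 1)"
  have \<delta>: "?\<delta> \<in> carrier (mult_of R)"
    by (rule mult.nat_pow_closed[OF gamma_closed])
  have "card (generate (mult_of R) {?\<delta>}) = mult.ord ?\<delta>"
    by (rule mult.generate_pow_card[OF \<delta>, symmetric])
  also have "\<dots> = mult.ord \<gamma> div (card K + 1)"
    using mult.ord_pow[OF gamma_closed, of "card K + 1"] by (simp add: ord_gamma del: mult_Suc)
  also have "\<dots> = card K - 1"
    unfolding ord_gamma by (rule nonzero_mult_div_cancel_left) simp
  finally have card: "card (generate (mult_of R) {?\<delta>}) = card K - 1" .
  have "subgroup (generate (mult_of R) {?\<delta>}) (mult_of R)"
    using \<delta> by (intro mult.generate_is_subgroup) simp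
  from subgroup_mult_of_eq_roots_of_unity[OF finite_carrier this] show ?thesis
    by (simp only: card nonzero_subfield_eq_roots_of_unity)
qed

lemma line_eq_image: "line i = (\<lambda>x. \<gamma> [^] i \<otimes> x) ` K"
proof -
  have "K = insert \<zero> (K - {\<zero>})"
    using subringE(2)[OF subfieldE(1)[OF subfield_K]] by auto
  then have "(\<lambda>x. \<gamma> [^] i \<otimes> x) ` K = insert \<zero> ((\<lambda>x. \<gamma> [^] i \<otimes> x) ` (K - {\<zero>}))"
    using gamma_pow_closed by (metis image_insert r_null)
  then show ?thesis
    unfolding line_def cyclotomic_class_def generate_gamma_pow
    by (auto simp: l_coset_def nat_pow_mult_of)
qed

lemma subgroup_line: "subgroup (line i) (add_monoid R)"
proof -
  interpret group_hom "add_monoid R" "add_monoid R" "\<lambda>x. \<gamma> [^] i \<otimes> x"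
    by unfold_locales (auto simp: hom_def r_distr gamma_pow_closed)
  show ?thesis
    unfolding line_eq_image
    by (rule subgroup_img_is_subgroup[OF subring.axioms(1)[OF subfieldE(1)[OF subfield_K]]])
qed

lemma card_line: "card (line i) = card K"
proof -
  have "inj_on (\<lambda>x. \<gamma> [^] i \<otimes> x) K"
    using gamma_pow_closed subfieldE(3)[OF subfield_K] by (auto simp: inj_on_def m_lcancel subset_iff)
  then show ?thesis
    by (simp add: line_eq_image card_image)
qed

lemma line_pow:
  assumes "y \<in> line i" "y \<noteq> \<zero>"
  shows "y [^] (card K - 1) = \<gamma> [^] (i * (card K - 1))"
proof -
  obtain u where u: "u \<in> K" "y = \<gamma> [^] i \<otimes> u"
    using assms(1) by (auto simp: line_eq_image)
  then have "u \<in> K - {\<zero>}"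
    using assms(2) gamma_pow_closed by auto
  then have "u \<in> carrier R" "u [^] (card K - 1) = \<one>"
    unfolding nonzero_subfield_eq_roots_of_unity by auto
  then show ?thesis
    using gamma_closed by (simp add: u(2) nat_pow_distrib gamma_pow_closed nat_pow_pow)
qed

lemma line_Int_line:
  assumes "i \<le> card K" "j \<le> card K" "i \<noteq> j"
  shows "line i \<inter> line j = {\<zero>}"
proof -
  have "y = \<zero>" if y: "y \<in> line i" "y \<in> line j" for y
  proof (rule ccontr)
    assume "y \<noteq> \<zero>"
    then have eq: "\<gamma> [^]\<^bsub>mult_of R\<^esub> (i * (card K - 1)) = \<gamma> [^]\<^bsub>mult_of R\<^esub> (j * (card K - 1))"
      using line_pow y by (metis nat_pow_mult_of)
    have "l * (card K - 1) \<in> {0..mult.ord \<gamma> - 1}" if "l \<le> card K" for l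
    proof -
      have "l * (card K - 1) < mult.ord \<gamma>"
        unfolding ord_gamma using that card_K_gt_1 by (intro mult_strict_right_mono) auto
      then show ?thesis by simp
    qed
    then have "i * (card K - 1) = j * (card K - 1)"
      using mult.ord_inj[OF gamma_closed] eq assms by (auto dest!: inj_onD)
    then show False
      using card_K_gt_1 assms(3) by simp
  qed
  then show ?thesis
    by (auto simp: line_def)
qed

end

subsection \<open>The even residues\<close>

lemma Collect_even_le_diff_2:
  assumes "even m"
  shows "{x. even x \<and> 0 \<le> x \<and> x \<le> int m - 2} = {x \<in> {0..<int m}. even x}"
proof -
  have "x \<le> int m - 2 \<longleftrightarrow> x < int m" if "even x" for x
    using that assms by presburger
  then show ?thesis
    by auto
qed

lemma shifted_evens_0:
  assumes "m > 0" "even m"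
  shows "shifted_evens m 0 = {x \<in> {0..<int m}. even x}"
proof -
  have "{x \<in> {0..<int m}. even x} \<subseteq> carrier (integer_mod_group m)"
    using assms(1) by (auto simp: carrier_integer_mod_group)
  then show ?thesis
    using group.lcos_mult_one[OF group_integer_mod_group, of _ m]
    by (simp add: shifted_evens_def Collect_even_le_diff_2[OF assms(2)])
qed

lemma shifted_evens_eq_l_coset:
  assumes "m > 0" "even m"
  shows "shifted_evens m l = l <#\<^bsub>integer_mod_group m\<^esub> shifted_evens m 0"
  unfolding shifted_evens_0[OF assms]
  by (simp add: shifted_evens_def Collect_even_le_diff_2[OF assms(2)])

lemma card_shifted_evens_0:
  assumes "m > 0" "even m"
  shows "card (shifted_evens m 0) = m div 2"
proof -
  have "shifted_evens m 0 = (\<lambda>k. 2 * k) ` {0..<int (m div 2)}"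
    unfolding shifted_evens_0[OF assms] using assms(2) by (auto elim!: evenE)
  then show ?thesis
    by (simp add: card_image inj_on_def)
qed

lemma even_mod_even: "even m \<Longrightarrow> even (x mod int m) \<longleftrightarrow> even x"
  by (simp add: dvd_mod_iff)

lemma subgroup_shifted_evens_0:
  assumes "m > 0" "even m"
  shows "subgroup (shifted_evens m 0) (integer_mod_group m)"
proof (rule group.subgroupI)
  show "shifted_evens m 0 \<noteq> {}"
    using assms by (auto simp: shifted_evens_0 intro!: exI[of _ 0])
qed (use assms in \<open>auto simp: shifted_evens_0 carrier_integer_mod_group even_mod_even\<close>)

lemma carrier_eq_shifted_evens:
  assumes "m > 0" "even m"
  shows "carrier (integer_mod_group m) = shifted_evens m 0 \<union> shifted_evens m 1"
proof -
  have carrier: "carrier (integer_mod_group m) = {0..<int m}"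
    using assms(1) by (simp add: carrier_integer_mod_group)
  show ?thesis
  proof (intro equalityI subsetI)
    fix x assume x: "x \<in> carrier (integer_mod_group m)"
    show "x \<in> shifted_evens m 0 \<union> shifted_evens m 1"
    proof (cases "even x")
      case True
      then show ?thesis
        using x assms by (simp add: carrier shifted_evens_0)
    next
      case False
      then have "x - 1 \<in> shifted_evens m 0" "x = (1 + (x - 1)) mod int m"
        using x assms by (auto simp: carrier shifted_evens_0 elim!: oddE)
      then show ?thesis
        unfolding shifted_evens_eq_l_coset[OF assms, of 1] l_coset_def mult_integer_mod_group
        by blast
    qed
  qed (use assms(1) in \<open>auto simp: carrier shifted_evens_def l_coset_def\<close>)
qed

lemma partial_geometric_difference_set_shifted_evens:
  assumes "m > 0" "even m"
    and "comm_group V" "subgroup A V" "subgroup B V" "A \<inter> B = {\<one>\<^bsub>V\<^esub>}"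
    and "card A = n" "card B = n" "order V = n\<^sup>2" "n > 1"
  shows "partial_geometric_difference_set (integer_mod_group m \<times>\<times> V) (m * n\<^sup>2) (m * n)
    ((m div 2)\<^sup>2 * (n * (n + 3))) ((3 * m\<^sup>2 * n) div 4)
    ((shifted_evens m 0 \<times> A) \<union> (shifted_evens m 1 \<times> B))"
proof -
  let ?Z = "integer_mod_group m" and ?E = "shifted_evens m 0"
  have l_coset: "1 <#\<^bsub>?Z\<^esub> ?E = shifted_evens m 1"
    by (rule shifted_evens_eq_l_coset[OF assms(1,2), symmetric])
  have "partial_geometric_difference_set (?Z \<times>\<times> V) (order ?Z * n\<^sup>2) (order ?Z * n)
    ((card ?E)\<^sup>2 * (n * (n + 3))) (3 * (card ?E)\<^sup>2 * n) ((?E \<times> A) \<union> ((1 <#\<^bsub>?Z\<^esub> ?E) \<times> B))"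
  proof (rule partial_geometric_difference_set_DirProd)
    show "finite (carrier ?Z)" "1 \<in> carrier ?Z" "1 \<notin> ?E"
      using assms(1,2) by (auto simp: carrier_integer_mod_group shifted_evens_0)
    show "carrier ?Z = ?E \<union> (1 <#\<^bsub>?Z\<^esub> ?E)"
      unfolding l_coset by (rule carrier_eq_shifted_evens[OF assms(1,2)])
  qed (rule abelian_integer_mod_group subgroup_shifted_evens_0 assms)+
  moreover have "order ?Z = m"
    using assms(1) by (simp add: order_def carrier_integer_mod_group)
  moreover have "3 * (m div 2)\<^sup>2 * n = (3 * m\<^sup>2 * n) div 4"
    using assms(2) by (auto elim!: evenE simp: power_mult_distrib)
  ultimately show ?thesis
    by (simp only: l_coset card_shifted_evens_0[OF assms(1,2)])
qed

theorem theorem3p3: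
  fixes F :: "('a, 'b) ring_scheme" and \<gamma> :: 'a and p m i' j' :: nat
  assumes "prime p"
    and "field F" and "order F = p ^ 2"
    and "primitive_element F \<gamma>"
    and "i' \<in> {0..p}" and "j' \<in> {0..p}" and "i' \<noteq> j'"
    and "m > 0" and "even m"
  shows "partial_geometric_difference_set (integer_mod_group m \<times>\<times> add_monoid F)
    (m * p ^ 2) (m * p) ((m div 2) ^ 2 * (p * (p + 3))) ((3 * m ^ 2 * p) div 4)
    ((shifted_evens m 0 \<times> (cyclotomic_class F (p + 1) \<gamma> i' \<union> {\<zero>\<^bsub>F\<^esub>})) \<union>
     (shifted_evens m 1 \<times> (cyclotomic_class F (p + 1) \<gamma> j' \<union> {\<zero>\<^bsub>F\<^esub>})))"
proof -
  interpret field F by fact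
  obtain K where K: "subfield K F" "card K = p"
    using ex_subfield_card_prime[OF assms(1,3)] by blast
  have "finite (carrier F)"
    using assms(1,3) prime_gt_0_nat order_gt_0_iff_finite by (metis zero_less_power)
  then interpret finite_quadratic_extension F K \<gamma>
    using assms(2-4) K by (simp add: finite_quadratic_extension_def finite_quadratic_extension_axioms_def)
  have "line i' \<inter> line j' = {\<one>\<^bsub>add_monoid F\<^esub>}"
    using line_Int_line[of i' j'] assms(5-7) K(2) by simp
  moreover have "order (add_monoid F) = p\<^sup>2"
    using assms(3) by (simp add: order_def)
  moreover have "card (line i') = p" "card (line j') = p"
    by (simp_all only: card_line K(2))
  ultimately show ?thesis
    using partial_geometric_difference_set_shifted_evens[OF assms(8,9) a_comm_group
        subgroup_line subgroup_line] prime_gt_1_nat[OF assms(1)]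
    by (simp only: line_def K(2))
qed

end
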